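(* There exist finite connected graphs $G\subseteq H$ on the same vertex set such that $G$ is stackable but $H$ is strongly non-stackable.
   Context: Cup stacking on a finite connected graph: initially one cup on every vertex; a move takes all $r\ge1$ cups from a vertex $x$ onto a vertex $y\neq x$ that already carries at least one cup and satisfies $d(x,y)=r$ (shortest-path distance). A graph is $t$-stackable if some sequence of moves ends with all cups on $t$; stackable if it is $t$-stackable for every vertex $t$; strongly non-stackable if it is not $t$-stackable for any vertex $t$. *)

theory Defs
  imports "Graph_Theory.Graph_Theory"
begin

(* A finite simple undirected graph is a pair_graph: a finite, loop-free digraph without
   parallel arcs whose arc relation is symmetric. *)

(* Shortest-path distance: all arcs have cost 1, so the cost of a walk is its length. *)
definition graph_dist :: "'a pair_pre_digraph \<Rightarrow> 'a \<Rightarrow> 'a \<Rightarrow> ereal" where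
  "graph_dist G u v = wf_digraph.\<mu> (with_proj G) (\<lambda>_. 1) u v"

lemma graph_dist_eq_iff:
  assumes "pair_wf_digraph G"
  shows "graph_dist G u v = ereal (real n) \<longleftrightarrow>
    (\<exists>p. pre_digraph.awalk (with_proj G) u p v \<and> length p = n) \<and>
    (\<forall>p. pre_digraph.awalk (with_proj G) u p v \<longrightarrow> n \<le> length p)"
proof -
  interpret pair_wf_digraph G by fact
  have wf: "wf_digraph (with_proj G)" by (rule wf_digraph)
  define A where "A = {p. pre_digraph.awalk (with_proj G) u p v}"
  have cost: "awalk_cost (\<lambda>_. 1) p = real (length p)" for p :: "('a \<times> 'a) awalk"
    by (induction p) auto
  have d: "graph_dist G u v = (INF p\<in>A. ereal (real (length p)))"
    unfolding graph_dist_def wf_digraph.\<mu>_def[OF wf] A_def cost ..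
  show ?thesis
  proof (cases "A = {}")
    case True
    then have "graph_dist G u v = \<infinity>"
      unfolding d by (simp add: top_ereal_def)
    moreover have "\<nexists>p. pre_digraph.awalk (with_proj G) u p v"
      using True unfolding A_def by blast
    ultimately show ?thesis
      by (metis PInfty_neq_ereal(1))
  next
    case False
    define m where "m = (LEAST k. k \<in> length ` A)"
    have m: "m \<in> length ` A"
      unfolding m_def using False by (metis (mono_tags) LeastI all_not_in_conv imageI)
    have le: "m \<le> length p" if "p \<in> A" for p
      unfolding m_def using that by (simp add: Least_le)
    have "graph_dist G u v = ereal (real m)"
      unfolding d
    proof (rule antisym)
      show "(INF p\<in>A. ereal (real (length p))) \<le> ereal (real m)"
        using m by (auto intro: INF_lower)
      show "ereal (real m) \<le> (INF p\<in>A. ereal (real (length p)))"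
        using le by (auto intro: INF_greatest)
    qed
    then have "graph_dist G u v = ereal (real n) \<longleftrightarrow> m = n"
      by simp
    also have "\<dots> \<longleftrightarrow> (\<exists>p\<in>A. length p = n) \<and> (\<forall>p\<in>A. n \<le> length p)"
    proof
      assume "m = n"
      then show "(\<exists>p\<in>A. length p = n) \<and> (\<forall>p\<in>A. n \<le> length p)"
        using m le by blast
    next
      assume *: "(\<exists>p\<in>A. length p = n) \<and> (\<forall>p\<in>A. n \<le> length p)"
      from m obtain q where "q \<in> A" "m = length q" by blast
      with * le show "m = n" by (metis le_antisym)
    qed
    finally show ?thesis
      unfolding A_def by blast
  qed
qed

(* A configuration assigns to every vertex the number of cups on it. *)
definition initial_cups :: "'a pair_pre_digraph \<Rightarrow> 'a \<Rightarrow> nat" where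
  "initial_cups G = (\<lambda>v. if v \<in> pverts G then 1 else 0)"

definition cup_move :: "'a pair_pre_digraph \<Rightarrow> ('a \<Rightarrow> nat) \<Rightarrow> ('a \<Rightarrow> nat) \<Rightarrow> bool" where
  "cup_move G c c' \<longleftrightarrow> (\<exists>x\<in>pverts G. \<exists>y\<in>pverts G. x \<noteq> y \<and> 1 \<le> c x \<and> 1 \<le> c y \<and>
     graph_dist G x y = ereal (real (c x)) \<and> c' = c(x := 0, y := c y + c x))"

definition stackable_at :: "'a pair_pre_digraph \<Rightarrow> 'a \<Rightarrow> bool" where
  "stackable_at G t \<longleftrightarrow>
     (\<exists>c. (cup_move G)\<^sup>*\<^sup>* (initial_cups G) c \<and> (\<forall>v\<in>pverts G. v \<noteq> t \<longrightarrow> c v = 0))"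

definition stackable :: "'a pair_pre_digraph \<Rightarrow> bool" where
  "stackable G \<longleftrightarrow> (\<forall>t\<in>pverts G. stackable_at G t)"

definition strongly_non_stackable :: "'a pair_pre_digraph \<Rightarrow> bool" where
  "strongly_non_stackable G \<longleftrightarrow> (\<forall>t\<in>pverts G. \<not> stackable_at G t)"

end

theory Submission
  imports Defs
begin

text \<open>
  The graph \<open>H\<close> is a complete graph in which two vertices \<open>h\<^sub>0, h\<^sub>1\<close> carry three pendant leaves each;
  it has diameter 3. A stack of at least three cups on the wrong vertex never gets off, so a leaf at \<open>h\<close>
  can only be cleared by sending its cup to \<open>h\<close> or by first receiving a single cup from \<open>h\<close>.
  Either happens for at most one leaf at \<open>h\<close>, and every target \<open>t\<close> leaves at least two to be cleared
  at one of \<open>h\<^sub>0\<close>, \<open>h\<^sub>1\<close>.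
  Deleting edges inside the complete part does not touch the leaves but creates large distances, along
  which leaves can be cleared by tall stacks; the sparse graph \<open>G\<close> and the move sequences
  towards each of its vertices come from a computer search.
\<close>

section \<open>Distances from potentials\<close>

text \<open>Each arc chosen by \<open>descent\<close> lowers the potential by exactly one, so the
  walk reaches potential 0 after \<open>d u\<close> arcs, and \<open>zero\<close> identifies its end
  as \<open>v\<close>.\<close>

lemma ex_awalk_potential:
  assumes "pair_wf_digraph G" and "u \<in> pverts G"
    and zero: "\<And>x. x \<in> pverts G \<Longrightarrow> d x = 0 \<Longrightarrow> x = v"
    and descent: "\<And>x. x \<in> pverts G \<Longrightarrow> x \<noteq> v \<Longrightarrow> \<exists>y. (x, y) \<in> parcs G \<and> d x = Suc (d y)"
    and "d v = 0"
  shows "\<exists>p. pre_digraph.awalk (with_proj G) u p v \<and> length p = d u"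
proof -
  interpret pair_wf_digraph G by fact
  show ?thesis
    using \<open>u \<in> pverts G\<close>
  proof (induction "d u" arbitrary: u)
    case 0
    then have "u = v" using zero by simp
    then show ?case using 0 \<open>d v = 0\<close> by (intro exI[of _ "[]"]) (simp add: awalk_Nil_iff)
  next
    case (Suc k)
    then have "u \<noteq> v" using \<open>d v = 0\<close> by auto
    then obtain y where y: "(u, y) \<in> parcs G" "d u = Suc (d y)"
      using descent Suc by blast
    then obtain p where "awalk y p v" "length p = d y"
      using Suc in_arcsD2 by (metis Suc_inject)
    then show ?case
      using y by (intro exI[of _ "(u, y) # p"]) (simp add: awalk_Cons_iff)
  qed
qed

text \<open>The lower bound comes from \<open>lipschitz\<close>: an arc lowers \<open>d\<close> by
  at most one, so no walk to \<open>v\<close> beats the descending one. Distances are thus certified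
  by local conditions.\<close>

lemma graph_dist_potential:
  assumes "pair_wf_digraph G" and "u \<in> pverts G"
    and zero: "\<And>x. x \<in> pverts G \<Longrightarrow> d x = 0 \<Longrightarrow> x = v"
    and descent: "\<And>x. x \<in> pverts G \<Longrightarrow> x \<noteq> v \<Longrightarrow> \<exists>y. (x, y) \<in> parcs G \<and> d x = Suc (d y)"
    and "d v = 0"
    and lipschitz: "\<And>x y. (x, y) \<in> parcs G \<Longrightarrow> d x \<le> Suc (d y)"
  shows "graph_dist G u v = ereal (real (d u))"
proof -
  interpret pair_wf_digraph G by fact
  have "d u \<le> length p" if "awalk u p v" for p
    using that
  proof (induction p arbitrary: u)
    case Nil
    then show ?case using \<open>d v = 0\<close> by (simp add: awalk_Nil_iff)
  next
    case (Cons e p)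
    obtain y where "e = (u, y)" "(u, y) \<in> parcs G" "awalk y p v"
      using Cons.prems by (cases e) (auto simp: awalk_Cons_iff)
    then show ?case using Cons.IH[of y] lipschitz[of u y] by simp
  qed
  then show ?thesis
    using ex_awalk_potential[of G u d v] assms by (subst graph_dist_eq_iff) auto
qed

section \<open>Graphs given by edge lists\<close>

definition edge_graph :: "nat \<Rightarrow> (nat \<times> nat) list \<Rightarrow> nat pair_pre_digraph" where
  "edge_graph n es = \<lparr>pverts = {..<n}, parcs = set es \<union> (set es)\<inverse>\<rparr>"

definition wf_edges :: "nat \<Rightarrow> (nat \<times> nat) list \<Rightarrow> bool" where
  "wf_edges n es \<longleftrightarrow> list_all (\<lambda>(u, v). u < n \<and> v < n \<and> u \<noteq> v) es"

text \<open>An executable certificate: for each \<open>w\<close>, the function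
  \<open>\<lambda>x. d x w\<close> is a potential for the target \<open>w\<close>. Descent makes its
  value a successor away from \<open>w\<close>, so \<open>w\<close> is its only zero.\<close>

definition is_distance :: "nat \<Rightarrow> (nat \<times> nat) list \<Rightarrow> (nat \<Rightarrow> nat \<Rightarrow> nat) \<Rightarrow> bool" where
  "is_distance n es d \<longleftrightarrow>
     list_all (\<lambda>(u, v). list_all (\<lambda>w. d u w \<le> Suc (d v w) \<and> d v w \<le> Suc (d u w)) [0..<n]) es \<and>
     list_all (\<lambda>u. list_all (\<lambda>w. if u = w then d u w = 0
       else list_ex (\<lambda>(x, y). x = u \<and> d u w = Suc (d y w) \<or> y = u \<and> d u w = Suc (d x w)) es)
       [0..<n]) [0..<n]"

lemma pverts_edge_graph [simp]: "pverts (edge_graph n es) = {..<n}"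
  by (simp add: edge_graph_def)

lemma parcs_edge_graph: "(u, v) \<in> parcs (edge_graph n es) \<longleftrightarrow> (u, v) \<in> set es \<or> (v, u) \<in> set es"
  by (simp add: edge_graph_def)

lemma pair_graph_edge_graph:
  assumes "wf_edges n es"
  shows "pair_graph (edge_graph n es)"
proof
  show "symmetric (with_proj (edge_graph n es))"
    by (auto simp: symmetric_def edge_graph_def intro!: symI)
qed (use assms in \<open>auto simp: edge_graph_def wf_edges_def list_all_iff\<close>)

lemma is_distance_descent:
  assumes "is_distance n es d" "x < n" "w < n" "x \<noteq> w"
  shows "\<exists>y. (x, y) \<in> parcs (edge_graph n es) \<and> d x w = Suc (d y w)"
proof -
  from assms have "list_ex (\<lambda>(a, b). a = x \<and> d x w = Suc (d b w) \<or> b = x \<and> d x w = Suc (d a w)) es"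
    by (auto simp: is_distance_def list_all_iff)
  then show ?thesis by (auto simp: list_ex_iff parcs_edge_graph)
qed

lemma is_distance_refl: "is_distance n es d \<Longrightarrow> w < n \<Longrightarrow> d w w = 0"
  by (auto simp: is_distance_def list_all_iff)

lemma graph_dist_edge_graph:
  assumes "wf_edges n es" "is_distance n es d" "u < n" "w < n"
  shows "graph_dist (edge_graph n es) u w = ereal (real (d u w))"
proof -
  interpret pair_graph "edge_graph n es" using assms(1) by (rule pair_graph_edge_graph)
  show ?thesis
  proof (rule graph_dist_potential[where d = "\<lambda>x. d x w"])
    fix x y assume "(x, y) \<in> parcs (edge_graph n es)"
    then show "d x w \<le> Suc (d y w)"
      using assms(2,4) by (auto simp: is_distance_def list_all_iff parcs_edge_graph)
  next
    fix x assume "x \<in> pverts (edge_graph n es)" "d x w = 0"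
    then show "x = w" using is_distance_descent[of n es d x w] assms(2,4) by auto
  qed (use assms is_distance_descent is_distance_refl in \<open>auto intro: pair_wf_digraph_axioms\<close>)
qed

lemma connected_edge_graph:
  assumes "wf_edges n es" "is_distance n es d" "0 < n"
  shows "Digraph_Component.connected (with_proj (edge_graph n es))"
proof -
  interpret pair_graph "edge_graph n es" using assms(1) by (rule pair_graph_edge_graph)
  show ?thesis
  proof (rule connectedI)
    show "pverts (edge_graph n es) \<noteq> {}" using assms(3) by auto
    fix u w assume "u \<in> pverts (edge_graph n es)" "w \<in> pverts (edge_graph n es)"
    then have "u < n" "w < n" by auto
    have "x = w" if "x < n" "d x w = 0" for x
      using is_distance_descent[of n es d x w] assms(2) that \<open>w < n\<close> by auto
    then have "\<exists>p. awalk u p w \<and> length p = d u w"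
      using assms(2) is_distance_descent is_distance_refl \<open>u < n\<close> \<open>w < n\<close> pair_wf_digraph_axioms
      by (intro ex_awalk_potential[where d = "\<lambda>x. d x w"]) auto
    \<comment> \<open>\<open>connected\<close> asks for reachability in the symmetric closure, to
      which walks of the graph carry over.\<close>
    then show "u \<rightarrow>\<^sup>*\<^bsub>with_proj (mk_symmetric (with_proj (edge_graph n es)))\<^esub> w"
      by (auto simp: reachable_awalk intro!: reachable_mk_symmetricI)
  qed
qed

lemma subgraph_edge_graph:
  assumes "wf_edges n es" "wf_edges n fs" "set es \<subseteq> set fs"
  shows "subgraph (with_proj (edge_graph n es)) (with_proj (edge_graph n fs))"
proof -
  interpret G: pair_graph "edge_graph n es" using assms(1) by (rule pair_graph_edge_graph)
  interpret H: pair_graph "edge_graph n fs" using assms(2) by (rule pair_graph_edge_graph)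
  show ?thesis
    using assms(3) G.wf_digraph H.wf_digraph
    by (auto simp: subgraph_def compatible_def parcs_edge_graph)
qed

section \<open>Executing move sequences\<close>

text \<open>An illegal move gives \<open>None\<close>, so a single evaluation checks both the
  legality of a sequence and its outcome.\<close>

fun play :: "(nat \<Rightarrow> nat \<Rightarrow> nat) \<Rightarrow> (nat \<times> nat) list \<Rightarrow> nat list \<Rightarrow> nat list option" where
  "play d [] cs = Some cs"
| "play d ((x, y) # ms) cs =
    (if x < length cs \<and> y < length cs \<and> x \<noteq> y \<and> 1 \<le> cs ! x \<and> 1 \<le> cs ! y \<and> d x y = cs ! x
     then play d ms (cs[x := 0, y := cs ! y + cs ! x]) else None)"

text \<open>The default 0 beyond the list makes \<open>config (replicate n 1)\<close> equal to the
  initial configuration also outside the vertex set.\<close>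

definition config :: "nat list \<Rightarrow> nat \<Rightarrow> nat" where
  "config cs v = (if v < length cs then cs ! v else 0)"

lemma play_sound:
  assumes "wf_edges n es" "is_distance n es d" "length cs = n" "play d ms cs = Some cs'"
  shows "(cup_move (edge_graph n es))\<^sup>*\<^sup>* (config cs) (config cs') \<and> length cs' = n"
  using assms(3,4)
proof (induction ms arbitrary: cs)
  case Nil
  then show ?case by simp
next
  case (Cons m ms)
  obtain x y where m: "m = (x, y)" by (cases m)
  let ?cs = "cs[x := 0, y := cs ! y + cs ! x]"
  have xy: "x < n" "y < n" "x \<noteq> y" "1 \<le> cs ! x" "1 \<le> cs ! y" "d x y = cs ! x"
    and play: "play d ms ?cs = Some cs'"
    using Cons.prems by (auto simp: m split: if_splits)
  have "config ?cs = (config cs)(x := 0, y := config cs y + config cs x)"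
    using xy Cons.prems(1) by (auto simp: config_def fun_eq_iff nth_list_update)
  then have "cup_move (edge_graph n es) (config cs) (config ?cs)"
    unfolding cup_move_def using xy Cons.prems(1) graph_dist_edge_graph[OF assms(1,2), of x y]
    by (intro bexI[of _ x] bexI[of _ y]) (auto simp: config_def)
  moreover have "(cup_move (edge_graph n es))\<^sup>*\<^sup>* (config ?cs) (config cs') \<and> length cs' = n"
    using Cons.IH[OF _ play] Cons.prems(1) by simp
  ultimately show ?case by (auto intro: converse_rtranclp_into_rtranclp)
qed

definition stacks_at :: "nat \<Rightarrow> (nat \<Rightarrow> nat \<Rightarrow> nat) \<Rightarrow> (nat \<times> nat) list \<Rightarrow> nat \<Rightarrow> bool" where
  "stacks_at n d ms t \<longleftrightarrow> (case play d ms (replicate n 1) of None \<Rightarrow> False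
     | Some cs \<Rightarrow> list_all (\<lambda>v. v = t \<or> cs ! v = 0) [0..<n])"

lemma stackable_at_edge_graph:
  assumes "wf_edges n es" "is_distance n es d" "stacks_at n d ms t"
  shows "stackable_at (edge_graph n es) t"
proof -
  obtain cs where cs: "play d ms (replicate n 1) = Some cs"
      "list_all (\<lambda>v. v = t \<or> cs ! v = 0) [0..<n]"
    using assms(3) unfolding stacks_at_def by (cases "play d ms (replicate n 1)") simp_all
  have "config (replicate n 1) = initial_cups (edge_graph n es)"
    by (auto simp: config_def initial_cups_def fun_eq_iff)
  then show ?thesis
    unfolding stackable_at_def using play_sound[OF assms(1,2) _ cs(1)] cs(2)
    by (intro exI[of _ "config cs"]) (auto simp: config_def list_all_iff)
qed

section \<open>Three pendant leaves at each of two vertices\<close>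

text \<open>
  \<open>A\<close> are the leaves at \<open>h\<close> and \<open>B\<close> those at the other vertex. A stack of three cups in \<open>B\<close> need not
  be stuck, as it may still move to a target in \<open>A\<close>.
\<close>

lemma not_stackable_at_two_brooms:
  assumes verts: "h \<in> pverts G" "A \<subseteq> pverts G" "B \<subseteq> pverts G"
    and disj: "h \<notin> A" "A \<inter> B = {}"
    and dist_le: "\<And>x y k. x \<in> pverts G \<Longrightarrow> y \<in> pverts G \<Longrightarrow>
      graph_dist G x y = ereal (real k) \<Longrightarrow> k \<le> 3"
    and dist_3: "\<And>x y. x \<in> pverts G \<Longrightarrow> y \<in> pverts G \<Longrightarrow>
      graph_dist G x y = ereal (real 3) \<Longrightarrow> x \<notin> B \<Longrightarrow> y \<in> B"
    and dist_1: "\<And>a y. a \<in> A \<Longrightarrow> y \<in> pverts G \<Longrightarrow>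
      graph_dist G a y = ereal (real 1) \<or> graph_dist G y a = ereal (real 1) \<Longrightarrow> y = h"
    and leaves: "p \<in> A" "q \<in> A" "p \<noteq> q" "p \<noteq> t" "q \<noteq> t"
    and t: "t \<notin> B" "t \<noteq> h" "h \<notin> B"
  shows "\<not> stackable_at G t"
proof -
  \<comment> \<open>This is permanent: distances are at most 3, so four cups never move, and three
    cups outside \<open>B\<close> can only move onto a nonempty vertex of \<open>B\<close>, making
    at least four. It also keeps cups away from \<open>t\<close>.\<close>
  define stuck where "stuck c \<longleftrightarrow> (\<exists>v\<in>pverts G. v \<noteq> t \<and> v \<notin> B \<and> 3 \<le> c v) \<or> (\<exists>v\<in>B. 4 \<le> c v)"
    for c :: "'a \<Rightarrow> nat"
  \<comment> \<open>Either \<open>h\<close>, \<open>p\<close> and \<open>q\<close> are untouched, or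
    the cup of \<open>h\<close> has been used: it has left (0, never refilled) or been joined by a
    single cup (2), and one of the two leaves still waits.\<close>
  define Inv where "Inv c \<longleftrightarrow> stuck c \<or> (c h = 1 \<and> c p = 1 \<and> c q = 1) \<or>
      (c h = 0 \<or> c h = 2) \<and> (c p = 1 \<or> c q = 1)"
    for c :: "'a \<Rightarrow> nat"
  have pq: "p \<in> pverts G" "q \<in> pverts G" "p \<notin> B" "q \<notin> B" "p \<noteq> h" "q \<noteq> h"
    using leaves verts disj by auto
  have step: "Inv c'" if "Inv c" and "cup_move G c c'" for c c'
  proof -
    obtain x y where xy: "x \<in> pverts G" "y \<in> pverts G" "x \<noteq> y" "1 \<le> c x" "1 \<le> c y"
      and d: "graph_dist G x y = ereal (real (c x))" and c': "c' = c(x := 0, y := c y + c x)"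
      using \<open>cup_move G c c'\<close> unfolding cup_move_def by blast
    have x3: "c x \<le> 3" using dist_le xy d by blast
    show ?thesis
    proof (cases "stuck c")
      case True
      have "stuck c'"
      proof (cases "\<exists>v\<in>pverts G. v \<noteq> t \<and> v \<notin> B \<and> 3 \<le> c v")
        case True
        then obtain v where v: "v \<in> pverts G" "v \<noteq> t" "v \<notin> B" "3 \<le> c v" by blast
        show ?thesis
        proof (cases "x = v")
          case True
          then have "c x = 3" using v x3 by simp
          then have "y \<in> B" using dist_3 xy d True v by metis
          then show ?thesis using c' \<open>c x = 3\<close> xy by (auto simp: stuck_def)
        next
          case False
          then show ?thesis using v c' unfolding stuck_def by (intro disjI1 bexI[of _ v]) auto
        qed
      next
        case False
        then obtain v where v: "v \<in> B" "4 \<le> c v" using \<open>stuck c\<close> unfolding stuck_def by blast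
        then have "x \<noteq> v" using x3 by auto
        then show ?thesis using v c' unfolding stuck_def by (intro disjI2 bexI[of _ v]) auto
      qed
      then show ?thesis by (simp add: Inv_def)
    next
      case False
      \<comment> \<open>Unless the move creates a stuck stack, its destination, if outside
        \<open>B\<close> and not \<open>t\<close>, ends with at most two cups; so both merged stacks
        are single cups. This drives \<open>y_h\<close> and \<open>y_leaf\<close>.\<close>
      have onto: "stuck c'" if "y \<in> pverts G" "y \<noteq> t" "y \<notin> B" "3 \<le> c y + c x"
        using that c' xy unfolding stuck_def by (intro disjI1 bexI[of _ y]) auto
      have leaf_x: "y = h" if "x = p \<or> x = q" "c x = 1"
        using that dist_1[of x y] d xy leaves by auto
      have leaf_y: "x = h" if "y = p \<or> y = q" "c x = 1"
        using that dist_1[of y x] d xy leaves by auto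
      show ?thesis
      proof (cases "stuck c'")
        case True
        then show ?thesis by (simp add: Inv_def)
      next
        case nstuck: False
        have y_h: "c h = 1" "c x = 1" if "y = h"
          using onto nstuck that verts t xy by fastforce+
        have y_leaf: "x = h" if "y = r" "r = p \<or> r = q" for r
        proof -
          have "c x = 1" using onto nstuck that pq leaves xy by fastforce
          then show ?thesis using leaf_y that by blast
        qed
        consider (fresh) "c h = 1" "c p = 1" "c q = 1"
          | (used) r where "c h = 0 \<or> c h = 2" "r = p \<or> r = q" "c r = 1"
          using \<open>Inv c\<close> False unfolding Inv_def by blast
        then have "(c' h = 1 \<and> c' p = 1 \<and> c' q = 1) \<or> (c' h = 0 \<or> c' h = 2) \<and> (c' p = 1 \<or> c' q = 1)"
        proof cases
          case fresh
          show ?thesis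
          proof (cases "y = h")
            case True
            \<comment> \<open>Now \<open>h\<close> holds two cups, and the arriving cup emptied at
              most one of \<open>p\<close> and \<open>q\<close>.\<close>
            then show ?thesis using y_h pq leaves fresh c' by (cases "x = p") auto
          next
            case False
            \<comment> \<open>Both leaves must stay. Only \<open>h\<close> can send a cup to one of
              them, which empties \<open>h\<close> and leaves the other leaf at 1.\<close>
            then have "x \<noteq> p" "x \<noteq> q" using leaf_x fresh by auto
            then show ?thesis
              using False y_leaf[of p] y_leaf[of q] fresh pq leaves c' by (cases "x = h"; cases "y = p") auto
          qed
        next
          case used
          \<comment> \<open>An empty \<open>h\<close> cannot receive, and a third cup would make it
            stuck; so the single cup on \<open>r\<close> has nowhere to go.\<close>
          then have "y \<noteq> h" using y_h by auto
          then have "x \<noteq> r" using leaf_x used by auto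
          moreover have "y \<noteq> r"
          proof
            \<comment> \<open>Only a single cup from \<open>h\<close> could join the cup on
              \<open>r\<close>, but \<open>h\<close> holds 0 or 2.\<close>
            assume "y = r"
            then have "x = h" using y_leaf used by blast
            moreover have "c x \<le> 1" using onto nstuck \<open>y = r\<close> used pq leaves xy by fastforce
            ultimately show False using used xy by auto
          qed
          ultimately have "c' r = 1" "c' h = 0 \<or> c' h = 2"
            using used c' \<open>y \<noteq> h\<close> by auto
          then show ?thesis using used by auto
        qed
        then show ?thesis by (simp add: Inv_def)
      qed
    qed
  qed
  have reach: "Inv c" if "(cup_move G)\<^sup>*\<^sup>* (initial_cups G) c" for c
    using that
  proof (induction rule: rtranclp_induct)
    case base
    then show ?case using verts pq by (simp add: Inv_def initial_cups_def)
  next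
    case (step c c')
    then show ?case using \<open>\<And>c c'. Inv c \<Longrightarrow> cup_move G c c' \<Longrightarrow> Inv c'\<close> by blast
  qed
  show ?thesis
  proof
    assume "stackable_at G t"
    then obtain c where "Inv c" and zero: "\<And>v. v \<in> pverts G \<Longrightarrow> v \<noteq> t \<Longrightarrow> c v = 0"
      using reach unfolding stackable_at_def by blast
    have "c p = 0" "c q = 0" using zero pq leaves by auto
    moreover have "\<not> stuck c"
      using zero verts t by (fastforce simp: stuck_def)
    ultimately show False using \<open>Inv c\<close> by (simp add: Inv_def)
  qed
qed

section \<open>The two graphs\<close>

text \<open>Vertices 0 and 1 are the two hubs, 9 to 14 the leaves; 0 to 8 span the part that is
  complete in the dense graph.\<close>

definition leaf_edges :: "(nat \<times> nat) list" where
  "leaf_edges = [(0,9), (0,10), (0,11), (1,12), (1,13), (1,14)]"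

text \<open>Apart from the leaves, this is the path 3, 6, 5, 2, 0, 4 continued by a diamond on 4, 7,
  8, 1 that lacks the edge between 4 and 1. The diameter is 8.\<close>

definition sparse_edges :: "(nat \<times> nat) list" where
  "sparse_edges = leaf_edges @
    [(0,2), (0,4), (2,5), (3,6), (5,6), (1,7), (4,7), (1,8), (4,8), (7,8)]"

definition dense_edges :: "(nat \<times> nat) list" where
  "dense_edges = leaf_edges @ concat (map (\<lambda>i. map (\<lambda>j. (i, j)) [Suc i..<9]) [0..<9])"

definition sparse_dist :: "nat \<Rightarrow> nat \<Rightarrow> nat" where
  "sparse_dist u v =
    [[0, 3, 1, 4, 1, 2, 3, 2, 2, 1, 1, 1, 4, 4, 4],
     [3, 0, 4, 7, 2, 5, 6, 1, 1, 4, 4, 4, 1, 1, 1],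
     [1, 4, 0, 3, 2, 1, 2, 3, 3, 2, 2, 2, 5, 5, 5],
     [4, 7, 3, 0, 5, 2, 1, 6, 6, 5, 5, 5, 8, 8, 8],
     [1, 2, 2, 5, 0, 3, 4, 1, 1, 2, 2, 2, 3, 3, 3],
     [2, 5, 1, 2, 3, 0, 1, 4, 4, 3, 3, 3, 6, 6, 6],
     [3, 6, 2, 1, 4, 1, 0, 5, 5, 4, 4, 4, 7, 7, 7],
     [2, 1, 3, 6, 1, 4, 5, 0, 1, 3, 3, 3, 2, 2, 2],
     [2, 1, 3, 6, 1, 4, 5, 1, 0, 3, 3, 3, 2, 2, 2],
     [1, 4, 2, 5, 2, 3, 4, 3, 3, 0, 2, 2, 5, 5, 5],
     [1, 4, 2, 5, 2, 3, 4, 3, 3, 2, 0, 2, 5, 5, 5],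
     [1, 4, 2, 5, 2, 3, 4, 3, 3, 2, 2, 0, 5, 5, 5],
     [4, 1, 5, 8, 3, 6, 7, 2, 2, 5, 5, 5, 0, 2, 2],
     [4, 1, 5, 8, 3, 6, 7, 2, 2, 5, 5, 5, 2, 0, 2],
     [4, 1, 5, 8, 3, 6, 7, 2, 2, 5, 5, 5, 2, 2, 0]] ! u ! v"

text \<open>\<open>hub\<close> projects a vertex to the complete part and \<open>height\<close> is
  its distance from there.\<close>

definition dense_dist :: "nat \<Rightarrow> nat \<Rightarrow> nat" where
  "dense_dist u v =
    (let hub = (\<lambda>x. if x < 9 then x else if x < 12 then 0 else 1);
         height = (\<lambda>x. if x < 9 then 0 else 1)
     in if u = v then 0 else height u + height v + (if hub u = hub v then 0 else 1))"

text \<open>Entry \<open>t\<close> is the sequence for target \<open>t\<close>. Every move empties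
  exactly one occupied vertex and fills none, so each sequence has 14 moves.\<close>

definition sparse_moves :: "(nat \<times> nat) list list" where
  "sparse_moves =
    [[(11,0), (10,0), (9,0), (8,4), (7,4), (4,12), (12,0),
      (5,6), (6,2), (2,3), (3,0), (14,1), (13,1), (1,0)],
     [(14,1), (13,1), (12,1), (8,7), (4,7), (7,2), (2,1),
      (6,5), (5,3), (11,0), (10,0), (9,0), (0,3), (3,1)],
     [(7,4), (4,2), (6,5), (5,3), (3,2), (13,1), (12,1),
      (8,1), (1,2), (11,0), (10,0), (9,0), (0,14), (14,2)],
     [(8,7), (4,7), (5,2), (2,9), (9,7), (7,3), (14,1),
      (13,1), (11,0), (10,0), (0,1), (1,6), (6,12), (12,3)],
     [(8,7), (7,12), (12,4), (6,5), (2,5), (5,4), (1,14),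
      (14,13), (13,4), (11,0), (10,0), (9,0), (0,3), (3,4)],
     [(7,4), (4,9), (9,5), (6,3), (3,5), (14,1), (13,1),
      (8,1), (1,2), (2,12), (12,5), (0,11), (11,10), (10,5)],
     [(8,7), (7,12), (12,4), (4,6), (3,6), (5,2), (2,6),
      (1,14), (14,13), (11,0), (10,0), (9,0), (0,13), (13,6)],
     [(8,4), (4,2), (2,7), (14,1), (13,1), (12,1), (1,9),
      (9,3), (3,7), (11,0), (0,5), (5,10), (10,6), (6,7)],
     [(7,4), (4,2), (2,8), (14,1), (13,1), (12,1), (1,9),
      (9,3), (3,8), (11,0), (0,5), (5,10), (10,6), (6,8)],
     [(3,6), (5,2), (2,6), (6,9), (8,7), (7,12), (1,13),
      (13,12), (12,9), (11,0), (10,0), (4,0), (0,14), (14,9)],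
     [(3,6), (5,2), (2,6), (6,10), (8,7), (7,12), (1,13),
      (13,12), (12,10), (11,0), (9,0), (4,0), (0,14), (14,10)],
     [(3,6), (5,2), (2,6), (6,11), (8,7), (7,12), (1,13),
      (13,12), (12,11), (10,0), (9,0), (4,0), (0,14), (14,11)],
     [(6,5), (7,4), (4,9), (9,5), (2,5), (5,12), (14,1),
      (13,1), (11,0), (0,8), (8,10), (10,1), (1,3), (3,12)],
     [(6,5), (7,4), (4,9), (9,5), (2,5), (5,13), (14,1),
      (12,1), (11,0), (0,8), (8,10), (10,1), (1,3), (3,13)],
     [(6,5), (7,4), (4,9), (9,5), (2,5), (5,14), (13,1),
      (12,1), (11,0), (0,8), (8,10), (10,1), (1,3), (3,14)]]"

lemma wf_sparse_edges: "wf_edges 15 sparse_edges"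
  by code_simp

lemma wf_dense_edges: "wf_edges 15 dense_edges"
  by code_simp

lemma sparse_edges_subset: "set sparse_edges \<subseteq> set dense_edges"
  by code_simp

lemma is_distance_sparse: "is_distance 15 sparse_edges sparse_dist"
  by code_simp

lemma is_distance_dense: "is_distance 15 dense_edges dense_dist"
  by code_simp

lemma stackable_sparse: "stackable (edge_graph 15 sparse_edges)"
proof -
  have "list_all (\<lambda>t. stacks_at 15 sparse_dist (sparse_moves ! t) t) [0..<15]"
    by code_simp
  then show ?thesis
    using stackable_at_edge_graph[OF wf_sparse_edges is_distance_sparse]
    unfolding stackable_def list_all_iff by fastforce
qed

lemma strongly_non_stackable_dense: "strongly_non_stackable (edge_graph 15 dense_edges)"
  unfolding strongly_non_stackable_def
proof
  let ?H = "edge_graph 15 dense_edges"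
  fix t assume "t \<in> pverts ?H"
  have dist: "graph_dist ?H u v = ereal (real k) \<longleftrightarrow> dense_dist u v = k" if "u < 15" "v < 15" for u v k
    using graph_dist_edge_graph[OF wf_dense_edges is_distance_dense that] by simp
  have le_3: "dense_dist u v \<le> 3" for u v
    by (simp add: dense_dist_def Let_def)
  \<comment> \<open>Distance 3 occurs only between leaves at different hubs, so
    \<open>dist_3\<close> holds with either leaf set as \<open>B\<close>.\<close>
  have eq_3: "u \<in> {9, 10, 11} \<and> v \<in> {12, 13, 14} \<or> u \<in> {12, 13, 14} \<and> v \<in> {9, 10, 11}"
    if "dense_dist u v = 3" "u < 15" "v < 15" for u v
    using that by (auto simp: dense_dist_def Let_def split: if_splits)
  have eq_1: "v = (if u < 12 then 0 else 1)"
    if "dense_dist u v = 1 \<or> dense_dist v u = 1" "9 \<le> u" for u v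
    using that by (auto simp: dense_dist_def Let_def split: if_splits)
  have no: "\<not> stackable_at ?H t"
    if hAB: "h = 0 \<and> A = {9, 10, 11} \<and> B = {12, 13, 14} \<or> h = 1 \<and> A = {12, 13, 14} \<and> B = {9, 10, 11}"
      and "p \<in> A" "q \<in> A" "p \<noteq> q" "p \<noteq> t" "q \<noteq> t" "t \<notin> B" "t \<noteq> h" for h A B p q
  proof (rule not_stackable_at_two_brooms[of h ?H A B p q t])
    fix x y k assume "x \<in> pverts ?H" "y \<in> pverts ?H" "graph_dist ?H x y = ereal (real k)"
    then show "k \<le> 3" using dist[of x y k] le_3[of x y] by simp
  next
    fix x y assume "x \<in> pverts ?H" "y \<in> pverts ?H" "graph_dist ?H x y = ereal (real 3)" "x \<notin> B"
    then show "y \<in> B" using dist[of x y 3] eq_3[of x y] hAB by auto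
  next
    fix a y assume "a \<in> A" "y \<in> pverts ?H"
      "graph_dist ?H a y = ereal (real 1) \<or> graph_dist ?H y a = ereal (real 1)"
    moreover from this have "a < 15" "9 \<le> a" "(if a < 12 then 0 else 1) = h" using hAB by auto
    ultimately show "y = h" using dist[of a y 1] dist[of y a 1] eq_1[of a y] by simp
  qed (use that in auto)
  show "\<not> stackable_at ?H t"
  \<comment> \<open>The hub is chosen so that \<open>t\<close> is neither the hub itself nor a leaf
    at the other one. At most one of its three leaves is then \<open>t\<close>, and the conditional
    witnesses pick two others.\<close>
  proof (cases "t = 0 \<or> t \<in> {12, 13, 14}")
    case True
    then show ?thesis
      by (intro no[of 1 "{12, 13, 14}" "{9, 10, 11}" "if t = 12 then 13 else 12" "if t = 14 then 13 else 14"])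
        auto
  next
    case False
    then show ?thesis
      by (intro no[of 0 "{9, 10, 11}" "{12, 13, 14}" "if t = 9 then 10 else 9" "if t = 11 then 10 else 11"])
        auto
  qed
qed

theorem theorem5p4:
  shows "\<exists>G H :: nat pair_pre_digraph.
    pair_graph G \<and> pair_graph H \<and>
    Digraph_Component.connected (with_proj G) \<and> Digraph_Component.connected (with_proj H) \<and>
    pverts G = pverts H \<and> subgraph (with_proj G) (with_proj H) \<and>
    stackable G \<and> strongly_non_stackable H"
proof (intro exI conjI)
  show "pair_graph (edge_graph 15 sparse_edges)" "pair_graph (edge_graph 15 dense_edges)"
    by (rule pair_graph_edge_graph, rule wf_sparse_edges wf_dense_edges)+
  show "Digraph_Component.connected (with_proj (edge_graph 15 sparse_edges))"
    by (rule connected_edge_graph[OF wf_sparse_edges is_distance_sparse]) simp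
  show "Digraph_Component.connected (with_proj (edge_graph 15 dense_edges))"
    by (rule connected_edge_graph[OF wf_dense_edges is_distance_dense]) simp
  show "subgraph (with_proj (edge_graph 15 sparse_edges)) (with_proj (edge_graph 15 dense_edges))"
    by (rule subgraph_edge_graph[OF wf_sparse_edges wf_dense_edges sparse_edges_subset])
qed (simp_all add: stackable_sparse strongly_non_stackable_dense)

end
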